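(* For every $m\geq 2$, the graph $H_m$ is a maximal outerplanar graph of order $n=9m+2$ with maximum degree $\Delta(H_m)=7$, $$\xi_{or}(H_m)=2m+2\qquad\text{and}\qquad \mathrm{fd}(H_m)=7m=\frac{7(n-2)}{9}.$$ In particular $\mathrm{fd}(H_m)/n\to 7/9$ as $m\to\infty$.
   Context: All graphs are finite and simple. A maximal outerplanar graph (MOP) of order $n\ge 3$ is a triangulation of a convex $n$-gon: its vertices are the $n$ corners of the polygon, and its edges are the $n$ sides (outer edges) together with a maximal set of pairwise non-crossing diagonals (chords). $N(v)$ denotes the open neighborhood of $v$. A dominating set $D$ of $G=(V,E)$ (every vertex outside $D$ has a neighbor in $D$) is a fair dominating set if $|N(u)\cap D|=|N(v)\cap D|$ for every two vertices $u,v\in V\setminus D$; $\mathrm{fd}(G)$ is the minimum cardinality of a fair dominating set of $G$. A set $Q\subseteq V$ is an out-regular set (OR-set) if $|N(u)\setminus Q|=|N(v)\setminus Q|>0$ for every $u,v\in Q$; $\xi_{or}(G)$ is the maximum cardinality of an OR-set of $G$. Construction of $H_m$. Let $\Gamma$ be the triangulation of the $11$-gon $w_0w_1\cdots w_{10}$ (with outer edges $w_jw_{j+1}$ for $0\le j\le 9$ and $w_{10}w_0$) with the eight chords $$w_1w_{10},\ w_2w_4,\ w_2w_{10},\ w_4w_8,\ w_4w_9,\ w_4w_{10},\ w_5w_8,\ w_6w_8.$$ For $m\ge 2$, $H_m$ is the graph obtained from $m$ disjoint copies $\Gamma^0,\ldots,\Gamma^{m-1}$ of $\Gamma$, where $\Gamma^i$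 has vertices $w_j^i$ ($0\le j\le 10$), by identifying, for each $0\le i\le m-2$, the outer edge $w_5^iw_6^i$ of $\Gamma^i$ with the outer edge $w_0^{i+1}w_{10}^{i+1}$ of $\Gamma^{i+1}$, so that $w_5^i=w_0^{i+1}$ and $w_6^i=w_{10}^{i+1}$ (the two identified edges become a single edge). *)

theory Defs
  imports "HOL-Analysis.Analysis"
begin

section \<open>Graphs\<close>

text \<open>A graph is a pair of a vertex set and a set of edges, each edge being a two-element set of
  vertices.\<close>

type_synonym 'a graph = "'a set \<times> 'a set set"

abbreviation verts :: "'a graph \<Rightarrow> 'a set" where
  "verts G \<equiv> fst G"

abbreviation edges :: "'a graph \<Rightarrow> 'a set set" where
  "edges G \<equiv> snd G"

definition simple_graph :: "'a graph \<Rightarrow> bool" where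
  "simple_graph G \<longleftrightarrow> finite (verts G) \<and> (\<forall>e\<in>edges G. e \<subseteq> verts G \<and> card e = 2)"

definition nbh :: "'a graph \<Rightarrow> 'a \<Rightarrow> 'a set" where
  "nbh G v = {u \<in> verts G. {u, v} \<in> edges G}"

definition max_degree :: "'a graph \<Rightarrow> nat" where
  "max_degree G = Max ((\<lambda>v. card (nbh G v)) ` verts G)"

section \<open>Fair domination and out-regular sets\<close>

definition dominating_set :: "'a graph \<Rightarrow> 'a set \<Rightarrow> bool" where
  "dominating_set G D \<longleftrightarrow> D \<subseteq> verts G \<and> (\<forall>v \<in> verts G - D. nbh G v \<inter> D \<noteq> {})"

definition fair_dominating_set :: "'a graph \<Rightarrow> 'a set \<Rightarrow> bool" where
  "fair_dominating_set G D \<longleftrightarrow> dominating_set G D \<and>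
     (\<forall>u \<in> verts G - D. \<forall>v \<in> verts G - D. card (nbh G u \<inter> D) = card (nbh G v \<inter> D))"

definition fd :: "'a graph \<Rightarrow> nat" where
  "fd G = Min {card D | D. fair_dominating_set G D}"

definition or_set :: "'a graph \<Rightarrow> 'a set \<Rightarrow> bool" where
  "or_set G Q \<longleftrightarrow> Q \<subseteq> verts G \<and>
     (\<forall>u\<in>Q. \<forall>v\<in>Q. card (nbh G u - Q) = card (nbh G v - Q) \<and> card (nbh G v - Q) > 0)"

definition xi_or :: "'a graph \<Rightarrow> nat" where
  "xi_or G = Max {card Q | Q. or_set G Q}"

section \<open>Maximal outerplanar graphs\<close>

text \<open>A map \<open>p\<close> places the elements of \<open>V\<close> at the corners of a convex polygon in the plane.\<close>

definition convex_placement :: "('a \<Rightarrow> real \<times> real) \<Rightarrow> 'a set \<Rightarrow> bool" where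
  "convex_placement p V \<longleftrightarrow> finite V \<and> card V \<ge> 3 \<and> inj_on p V \<and>
     (\<forall>v\<in>V. p v extreme_point_of (convex hull (p ` V)))"

text \<open>Sides and diagonals are recorded as pairs of elements of \<open>V\<close>. In \<open>sides\<close> the two ends are
  distinct, because an \<^const>\<open>edge_of\<close> has affine dimension 1.\<close>

definition sides :: "('a \<Rightarrow> real \<times> real) \<Rightarrow> 'a set \<Rightarrow> 'a set set" where
  "sides p V = {{u, v} | u v. u \<in> V \<and> v \<in> V \<and>
     closed_segment (p u) (p v) edge_of (convex hull (p ` V))}"

definition diagonals :: "('a \<Rightarrow> real \<times> real) \<Rightarrow> 'a set \<Rightarrow> 'a set set" where
  "diagonals p V = {{u, v} | u v. u \<in> V \<and> v \<in> V \<and> u \<noteq> v} - sides p V"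

text \<open>Diagonals that merely share an endpoint do not cross: the segments below are open.\<close>

definition crossing :: "('a \<Rightarrow> real \<times> real) \<Rightarrow> 'a set \<Rightarrow> 'a set \<Rightarrow> bool" where
  "crossing p e f \<longleftrightarrow> (\<exists>u v x y. e = {u, v} \<and> f = {x, y} \<and>
     open_segment (p u) (p v) \<inter> open_segment (p x) (p y) \<noteq> {})"

definition noncrossing :: "('a \<Rightarrow> real \<times> real) \<Rightarrow> 'a set set \<Rightarrow> bool" where
  "noncrossing p C \<longleftrightarrow> pairwise (\<lambda>e f. \<not> crossing p e f) C"

definition maximal_noncrossing :: "('a \<Rightarrow> real \<times> real) \<Rightarrow> 'a set \<Rightarrow> 'a set set \<Rightarrow> bool" where
  "maximal_noncrossing p V C \<longleftrightarrow> C \<subseteq> diagonals p V \<and> noncrossing p C \<and>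
     (\<forall>C'. C \<subseteq> C' \<and> C' \<subseteq> diagonals p V \<and> noncrossing p C' \<longrightarrow> C' = C)"

definition maximal_outerplanar :: "'a graph \<Rightarrow> bool" where
  "maximal_outerplanar G \<longleftrightarrow> (\<exists>p C. convex_placement p (verts G) \<and>
     maximal_noncrossing p (verts G) C \<and> edges G = sides p (verts G) \<union> C)"

lemma maximal_outerplanar_imp_simple_graph:
  assumes "maximal_outerplanar G"
  shows "simple_graph G"
proof -
  obtain p C where pC: "convex_placement p (verts G)" "C \<subseteq> diagonals p (verts G)"
      "edges G = sides p (verts G) \<union> C"
    using assms by (auto simp: maximal_outerplanar_def maximal_noncrossing_def)
  have "u \<noteq> v" if "closed_segment (p u) (p v) edge_of S" for u v S
    using that by (auto simp: edge_of_def)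
  then have "e \<subseteq> verts G \<and> card e = 2" if "e \<in> edges G" for e
    using that pC(2,3) by (fastforce simp: sides_def diagonals_def)
  then show ?thesis
    using pC(1) by (auto simp: simple_graph_def convex_placement_def)
qed

section \<open>The graphs \<open>H m\<close>\<close>

definition Gamma_edges :: "nat set set" where
  "Gamma_edges = {{j, j + 1} | j. j \<le> 9} \<union> {{10, 0}} \<union>
     {{1, 10}, {2, 4}, {2, 10}, {4, 8}, {4, 9}, {4, 10}, {5, 8}, {6, 8}}"

text \<open>\<open>w i j\<close> is the vertex \<open>j\<close> of the copy \<open>i\<close> of the 11-gon after the identifications. Copies are
  numbered from 0, and a vertex lying in two copies is named after the lower one.\<close>

definition w :: "nat \<Rightarrow> nat \<Rightarrow> nat \<times> nat" where
  "w i j = (if i > 0 \<and> j = 0 then (i - 1, 5) else if i > 0 \<and> j = 10 then (i - 1, 6) else (i, j))"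

text \<open>The identifications made by \<open>w\<close> are exactly the prescribed ones.\<close>

lemma w_eq_iff:
  "w i j = w i' j' \<longleftrightarrow> (i, j) = (i', j') \<or>
     i' = Suc i \<and> (j = 5 \<and> j' = 0 \<or> j = 6 \<and> j' = 10) \<or>
     i = Suc i' \<and> (j' = 5 \<and> j = 0 \<or> j' = 6 \<and> j = 10)"
  by (cases i; cases i') (auto simp: w_def)

definition H :: "nat \<Rightarrow> (nat \<times> nat) graph" where
  "H m = ({w i j | i j. i < m \<and> j \<le> 10}, {w i ` e | i e. i < m \<and> e \<in> Gamma_edges})"

end

theory Submission
  imports Defs
begin

text \<open>Placing the vertices on a parabola in their order along the outer cycle turns crossing of
  diagonals into interleaving of positions. A set of edges without interleavings that contains all
  sides, and in which every edge except the short sides has an apex between its ends, is then a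
  maximal noncrossing one.

  Complements of fair dominating sets are exactly the out-regular sets, so \<open>fd\<close> is the order minus
  \<open>xi_or\<close>. For the upper bound on \<open>xi_or\<close>, fix the common number \<open>k\<close> of outside neighbours. The
  copies of the 11-gon meet only in edges, so the set can be scanned copy by copy, and a potential
  on the state at the glued edge shows that each copy contributes at most 2 elements on average. For
  \<open>k = 2\<close> the vertices 3 and 7 of each copy, corrected at both ends, attain the bound.\<close>

section \<open>Triangulations of a polygon inscribed in a parabola\<close>

definition parabola :: "nat \<Rightarrow> real \<times> real" where
  "parabola k = (real k, (real k)\<^sup>2)"

lemma parabola_inject [simp]: "parabola k = parabola l \<longleftrightarrow> k = l"
  by (simp add: parabola_def)

section \<open>Chords of the parabola and their crossings\<close>

lemma open_segment_parabola:
  assumes "a < b"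
  shows "z \<in> open_segment (parabola a) (parabola b) \<longleftrightarrow>
    real a < fst z \<and> fst z < real b \<and> snd z = (real a + real b) * fst z - real a * real b"
proof
  assume "z \<in> open_segment (parabola a) (parabola b)"
  then obtain u where u: "0 < u" "u < 1" and z: "z = (1 - u) *\<^sub>R parabola a + u *\<^sub>R parabola b"
    by (auto simp: in_segment)
  have f: "fst z = real a + u * (real b - real a)"
    and s: "snd z = (1 - u) * (real a)\<^sup>2 + u * (real b)\<^sup>2"
    by (simp_all add: z parabola_def algebra_simps)
  have "0 < u * (real b - real a)" "0 < (1 - u) * (real b - real a)"
    using u assms by simp_all
  then show "real a < fst z \<and> fst z < real b \<and> snd z = (real a + real b) * fst z - real a * real b"
    by (simp add: f s algebra_simps power2_eq_square)
next
  assume z: "real a < fst z \<and> fst z < real b \<and> snd z = (real a + real b) * fst z - real a * real b"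
  define u where "u = (fst z - a) / (real b - real a)"
  have ab: "real b - real a > 0" using assms by simp
  then have u: "0 < u" "u < 1" using z by (simp_all add: u_def)
  have f: "fst z = real a + u * (real b - real a)" using ab by (simp add: u_def)
  moreover have "snd z = (real a + real b) * (real a + u * (real b - real a)) - real a * real b"
    using z f by simp
  ultimately have "z = (1 - u) *\<^sub>R parabola a + u *\<^sub>R parabola b"
    by (intro prod_eqI) (simp_all add: parabola_def algebra_simps power2_eq_square)
  then show "z \<in> open_segment (parabola a) (parabola b)"
    using u assms by (auto simp: in_segment)
qed

lemma parabola_in_closed_segment:
  assumes "a < b" "parabola c \<in> closed_segment (parabola a) (parabola b)"
  shows "c = a \<or> c = b"
proof (rule ccontr)
  assume c: "\<not> (c = a \<or> c = b)"
  then have "parabola c \<in> open_segment (parabola a) (parabola b)"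
    using assms by (auto simp: open_segment_def)
  then have "(real c - real a) * (real c - real b) = 0"
    using open_segment_parabola[OF assms(1)] by (simp add: parabola_def power2_eq_square algebra_simps)
  then show False using c by simp
qed

text \<open>The chords over \<open>{a, b}\<close> and \<open>{c, d}\<close> lie on the lines \<open>y = (a + b) x - a b\<close> and
  \<open>y = (c + d) x - c d\<close>, which meet at \<open>x = (c d - a b) / (c + d - a - b)\<close>.\<close>

lemma interleaved_imp_crossing:
  assumes "a < c" "c < b" "b < d"
  shows "open_segment (parabola a) (parabola b) \<inter> open_segment (parabola c) (parabola d) \<noteq> {}"
proof -
  define A B C D where "A = real a" and "B = real b" and "C = real c" and "D = real d"
  have o: "A < C" "C < B" "B < D" using assms by (simp_all add: A_def B_def C_def D_def)
  define s where "s = C + D - A - B"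
  define x where "x = (C * D - A * B) / s"
  have s: "s > 0" using o by (simp add: s_def)
  have xs: "x * s = C * D - A * B" using s by (simp add: x_def)
  have 1: "(x - C) * s = (C - A) * (B - C)" and 2: "(B - x) * s = (B - C) * (D - B)"
    using xs by (simp_all add: s_def algebra_simps)
  have "(x - C) * s > 0" "(B - x) * s > 0" unfolding 1 2 using o by simp_all
  then have x: "C < x" "x < B" using s by (simp_all add: zero_less_mult_iff)
  have y: "(A + B) * x - A * B = (C + D) * x - C * D"
    using xs by (simp add: s_def algebra_simps)
  have "(x, (A + B) * x - A * B) \<in> open_segment (parabola a) (parabola b)"
    "(x, (A + B) * x - A * B) \<in> open_segment (parabola c) (parabola d)"
    using o x y assms unfolding A_def B_def C_def D_def by (subst open_segment_parabola; simp)+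
  then show ?thesis by blast
qed

text \<open>At abscissa \<open>x\<close> the chord over \<open>{a, b}\<close> lies above the
  parabola by \<open>(x - a) * (b - x)\<close>. Enlarging the interval strictly increases this
  height, so nested chords do not meet. Disjoint intervals have no common \<open>x\<close>, which
  leaves the interleaved ones.\<close>

lemma crossing_imp_interleaved:
  assumes "a < b" "c < d" "(a, b) \<noteq> (c, d)"
    and "open_segment (parabola a) (parabola b) \<inter> open_segment (parabola c) (parabola d) \<noteq> {}"
  shows "a < c \<and> c < b \<and> b < d \<or> c < a \<and> a < d \<and> d < b"
proof -
  obtain z where z: "z \<in> open_segment (parabola a) (parabola b)" "z \<in> open_segment (parabola c) (parabola d)"
    using assms(4) by blast
  define x where "x = fst z"
  have x: "real a < x" "x < real b" "real c < x" "x < real d"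
    and eq: "(x - real a) * (real b - x) = (x - real c) * (real d - x)"
    using z unfolding open_segment_parabola[OF assms(1)] open_segment_parabola[OF assms(2)] x_def
    by (auto simp: algebra_simps)
  have nested: "(x - p) * (q - x) < (x - p') * (q' - x)"
    if "p' \<le> p" "q \<le> q'" "p < x" "x < q" "(p, q) \<noteq> (p', q')" for p q p' q' :: real
  proof (cases "p' = p")
    case True
    then show ?thesis unfolding True by (intro mult_strict_left_mono) (use that True in auto)
  next
    case False
    then have "(x - p) * (q - x) < (x - p') * (q - x)"
      using that by (intro mult_strict_right_mono) auto
    also have "\<dots> \<le> (x - p') * (q' - x)"
      using that by (intro mult_left_mono) auto
    finally show ?thesis .
  qed
  have "\<not> (a \<le> c \<and> d \<le> b)" "\<not> (c \<le> a \<and> b \<le> d)"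
    using nested[of a c d b] nested[of c a b d] x eq assms(3) by auto
  moreover have "c < b" "a < d" using x by linarith+
  ultimately show ?thesis by linarith
qed

section \<open>Corners and sides of the inscribed polygon as faces of its hull\<close>

lemma face_of_convex_hull_hyperplane:
  fixes S :: "'a::euclidean_space set"
  assumes "finite S" "\<And>x. x \<in> S \<Longrightarrow> c \<bullet> x \<ge> d"
  shows "convex hull (S \<inter> {x. c \<bullet> x = d}) face_of convex hull S"
proof -
  have "convex hull S \<subseteq> {x. c \<bullet> x \<ge> d}"
    using assms(2) by (intro hull_minimal) (auto simp: convex_halfspace_ge)
  then have face: "convex hull S \<inter> {x. c \<bullet> x = d} face_of convex hull S"
    by (intro face_of_Int_supporting_hyperplane_ge) auto
  then obtain S' where S': "S' \<subseteq> S" "convex hull S \<inter> {x. c \<bullet> x = d} = convex hull S'"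
    using face_of_convex_hull_subset[of S] finite_imp_compact[OF assms(1)] by metis
  have "S' \<subseteq> S \<inter> {x. c \<bullet> x = d}" using S' hull_subset[of S' convex] by blast
  then have "convex hull S' \<subseteq> convex hull (S \<inter> {x. c \<bullet> x = d})" by (rule hull_mono)
  moreover have "convex hull (S \<inter> {x. c \<bullet> x = d}) \<subseteq> convex hull S \<inter> {x. c \<bullet> x = d}"
    by (intro hull_minimal Int_greatest convex_Int convex_hyperplane convex_convex_hull)
      (auto intro: hull_inc)
  ultimately show ?thesis using face S'(2) by auto
qed

text \<open>On the parabola a linear functional is a quadratic polynomial in \<open>k\<close>, so a
  face is exhibited by a quadratic whose minimum on \<open>K\<close> is attained exactly at the
  wanted corners.\<close>

lemma parabola_face:
  assumes "finite K" "\<And>k. k \<in> K \<Longrightarrow> \<alpha> * real k + \<beta> * (real k)\<^sup>2 \<ge> d"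
  shows "convex hull (parabola ` {k \<in> K. \<alpha> * real k + \<beta> * (real k)\<^sup>2 = d}) face_of convex hull (parabola ` K)"
proof -
  have "parabola ` {k \<in> K. \<alpha> * real k + \<beta> * (real k)\<^sup>2 = d} =
      parabola ` K \<inter> {x. (\<alpha>, \<beta>) \<bullet> x = d}"
    by (auto simp: parabola_def inner_prod_def)
  moreover have "(\<alpha>, \<beta>) \<bullet> x \<ge> d" if "x \<in> parabola ` K" for x
    using that assms(2) by (auto simp: parabola_def inner_prod_def)
  ultimately show ?thesis
    using face_of_convex_hull_hyperplane[of "parabola ` K" d "(\<alpha>, \<beta>)"] assms(1) by simp
qed

text \<open>The tangent at \<open>parabola k\<close> is a supporting line: up to a constant its
  quadratic is \<open>(l - k)^2\<close>, minimal only at \<open>l = k\<close>.\<close>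

lemma parabola_extreme_point:
  assumes "finite K" "k \<in> K"
  shows "parabola k extreme_point_of convex hull (parabola ` K)"
proof -
  have eq: "(-2 * real k) * real l + 1 * (real l)\<^sup>2 = (real l - real k)\<^sup>2 - (real k)\<^sup>2" for l
    by (simp add: power2_eq_square algebra_simps)
  have "{l \<in> K. (-2 * real k) * real l + 1 * (real l)\<^sup>2 = - (real k)\<^sup>2} = {k}"
    unfolding eq using assms(2) by auto
  then show ?thesis
    using parabola_face[OF assms(1), of "- (real k)\<^sup>2" "-2 * real k" 1] unfolding eq
    by (simp flip: face_of_singleton)
qed

text \<open>Any other chord is crossed by a chord from \<open>Suc a\<close> to a corner beyond its
  ends, and a face containing an inner point of a segment contains both ends of that segment.
  Conversely, the supporting line comes from \<open>(k - a) * (k - b)\<close>, nonnegative at all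
  integers if \<open>a\<close> and \<open>b\<close> are consecutive, and from its negative for the
  long side.\<close>

lemma parabola_edge_iff:
  assumes "3 \<le> n" "a < b" "b < n"
  shows "closed_segment (parabola a) (parabola b) edge_of convex hull (parabola ` {..<n}) \<longleftrightarrow>
    b = Suc a \<or> a = 0 \<and> b = n - 1"
    (is "?F edge_of ?P \<longleftrightarrow> _")
proof
  assume "?F edge_of ?P"
  then have face: "?F face_of ?P" by (simp add: edge_of_def)
  show "b = Suc a \<or> a = 0 \<and> b = n - 1"
  proof (rule ccontr)
    assume "\<not> (b = Suc a \<or> a = 0 \<and> b = n - 1)"
    then have "Suc a < b" "0 < a \<or> Suc b < n" using assms by auto
    then obtain d where d: "d < n" "d < a \<or> b < d"
      using assms(3) that[of 0] that[of "Suc b"] by auto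
    have "open_segment (parabola a) (parabola b) \<inter> open_segment (parabola (Suc a)) (parabola d) \<noteq> {}"
      using d(2)
    proof
      assume "d < a"
      then show ?thesis
        using interleaved_imp_crossing[of d a "Suc a" b] \<open>Suc a < b\<close> by (auto simp: open_segment_commute)
    next
      assume "b < d"
      then show ?thesis using interleaved_imp_crossing[of a "Suc a" b d] \<open>Suc a < b\<close> by auto
    qed
    then obtain z where "z \<in> ?F" "z \<in> open_segment (parabola (Suc a)) (parabola d)"
      by (auto simp: open_segment_def)
    moreover have "parabola (Suc a) \<in> ?P" "parabola d \<in> ?P"
      using d(1) \<open>Suc a < b\<close> assms by (auto intro!: hull_inc)
    ultimately have "parabola (Suc a) \<in> ?F" using face by (auto simp: face_of_def)
    then show False using parabola_in_closed_segment[OF assms(2), of "Suc a"] \<open>Suc a < b\<close> by simp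
  qed
next
  assume ab: "b = Suc a \<or> a = 0 \<and> b = n - 1"
  have "\<exists>\<alpha> \<beta> d. (\<forall>k<n. \<alpha> * real k + \<beta> * (real k)\<^sup>2 \<ge> d) \<and>
      {k \<in> {..<n}. \<alpha> * real k + \<beta> * (real k)\<^sup>2 = d} = {a, b}"
    using ab
  proof
    assume b: "b = Suc a"
    have eq: "- (2 * real a + 1) * real k + 1 * (real k)\<^sup>2 =
        (real k - real a) * (real k - real b) - real a * (real a + 1)" for k
      by (simp add: b power2_eq_square algebra_simps)
    have "(real k - real a) * (real k - real b) \<ge> 0" for k
      by (cases "k \<le> a") (auto simp: b intro: mult_nonpos_nonpos mult_nonneg_nonneg)
    then have "(\<forall>k<n. - (2 * real a + 1) * real k + 1 * (real k)\<^sup>2 \<ge> - (real a * (real a + 1))) \<and>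
      {k \<in> {..<n}. - (2 * real a + 1) * real k + 1 * (real k)\<^sup>2 = - (real a * (real a + 1))} = {a, b}"
      unfolding eq using assms by auto
    then show ?thesis by blast
  next
    assume b: "a = 0 \<and> b = n - 1"
    have eq: "real b * real k + (- 1) * (real k)\<^sup>2 = (real k - real a) * (real b - real k)" for k
      using b by (simp add: power2_eq_square algebra_simps)
    have "(\<forall>k<n. real b * real k + (- 1) * (real k)\<^sup>2 \<ge> 0) \<and>
      {k \<in> {..<n}. real b * real k + (- 1) * (real k)\<^sup>2 = 0} = {a, b}"
      unfolding eq using b assms by auto
    then show ?thesis by blast
  qed
  then obtain \<alpha> \<beta> d where
    "\<forall>k<n. \<alpha> * real k + \<beta> * (real k)\<^sup>2 \<ge> d" "{k \<in> {..<n}. \<alpha> * real k + \<beta> * (real k)\<^sup>2 = d} = {a, b}"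
    by blast
  then have "convex hull (parabola ` {a, b}) face_of ?P"
    using parabola_face[of "{..<n}" d \<alpha> \<beta>] by simp
  then show "?F edge_of ?P"
    using assms(2) by (simp add: edge_of_def segment_convex_hull aff_dim_convex_hull aff_dim_2)
qed

text \<open>This removes all geometry: \<open>pos\<close> is the position along the outer cycle, and
  \<open>planar\<close> and \<open>apex\<close> only compare positions. The closing side also
  satisfies \<open>apex\<close>, so it can serve as the first edge spanning a missing
  diagonal.\<close>

lemma maximal_outerplanarI:
  fixes V :: "'a set"
  assumes bij: "bij_betw pos V {..<n}" and n: "3 \<le> n"
    and pairs: "\<And>e. e \<in> E \<Longrightarrow> \<exists>u\<in>V. \<exists>v\<in>V. e = {u, v} \<and> pos u < pos v"
    and path: "\<And>k. Suc k < n \<Longrightarrow> \<exists>u\<in>V. \<exists>v\<in>V. pos u = k \<and> pos v = Suc k \<and> {u, v} \<in> E"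
    and closing: "\<exists>u\<in>V. \<exists>v\<in>V. pos u = 0 \<and> pos v = n - 1 \<and> {u, v} \<in> E"
    and planar: "\<And>u v x y. {u, v} \<in> E \<Longrightarrow> {x, y} \<in> E \<Longrightarrow> \<not> (pos u < pos x \<and> pos x < pos v \<and> pos v < pos y)"
    and apex: "\<And>u v. {u, v} \<in> E \<Longrightarrow> Suc (pos u) < pos v \<Longrightarrow>
      \<exists>t\<in>V. pos u < pos t \<and> pos t < pos v \<and> {u, t} \<in> E \<and> {t, v} \<in> E"
  shows "maximal_outerplanar (V, E)"
proof -
  define p where "p = parabola \<circ> pos"
  have inj: "inj_on pos V" and img: "pos ` V = {..<n}" using bij by (auto simp: bij_betw_def)
  have fin: "finite V" and card: "card V = n" using bij bij_betw_finite bij_betw_same_card by fastforce+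
  have pV: "p ` V = parabola ` {..<n}" unfolding p_def image_comp[symmetric] img ..
  have lt: "pos v < n" if "v \<in> V" for v using img that by auto
  have placement: "convex_placement p V"
    unfolding convex_placement_def pV using fin card n inj lt
    by (auto simp: p_def inj_on_def intro!: parabola_extreme_point)
  have side_iff: "{u, v} \<in> sides p V \<longleftrightarrow> pos v = Suc (pos u) \<or> pos u = 0 \<and> pos v = n - 1"
    if "u \<in> V" "v \<in> V" "pos u < pos v" for u v
    using that parabola_edge_iff[OF n that(3) lt[OF that(2)]]
    unfolding sides_def pV by (auto simp: p_def doubleton_eq_iff closed_segment_commute)
  have sidesE: "\<exists>u\<in>V. \<exists>v\<in>V. e = {u, v} \<and> pos u < pos v" if side: "e \<in> sides p V" for e
  proof -
    obtain u v where uv: "e = {u, v}" "u \<in> V" "v \<in> V" "closed_segment (p u) (p v) edge_of convex hull (p ` V)"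
      using side by (auto simp: sides_def)
    then have "u \<noteq> v" by (auto simp: edge_of_def)
    then have "pos u < pos v \<or> pos v < pos u" using inj uv by (metis inj_onD nat_neq_iff)
    then show ?thesis using uv by (metis insert_commute)
  qed
  have side_edge: "sides p V \<subseteq> E"
  proof
    fix e assume e: "e \<in> sides p V"
    then obtain u v where uv: "u \<in> V" "v \<in> V" "e = {u, v}" "pos u < pos v" using sidesE by metis
    then consider "pos v = Suc (pos u)" | "pos u = 0" "pos v = n - 1" using side_iff[OF uv(1,2,4)] e uv(3) by auto
    then show "e \<in> E"
    proof cases
      case 1
      then show ?thesis using path[of "pos u"] lt[of v] inj uv by (metis inj_onD)
    next
      case 2
      then show ?thesis using closing inj uv by (metis inj_onD)
    qed
  qed
  have crossing_iff: "crossing p {u, v} {x, y} \<longleftrightarrow>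
      pos u < pos x \<and> pos x < pos v \<and> pos v < pos y \<or> pos x < pos u \<and> pos u < pos y \<and> pos y < pos v"
    if "u \<in> V" "v \<in> V" "x \<in> V" "y \<in> V" "pos u < pos v" "pos x < pos y" "{u, v} \<noteq> {x, y}" for u v x y
  proof -
    have ne: "(pos u, pos v) \<noteq> (pos x, pos y)" using that inj by (auto dest: inj_onD)
    have "crossing p {u, v} {x, y} \<longleftrightarrow> open_segment (p u) (p v) \<inter> open_segment (p x) (p y) \<noteq> {}"
      unfolding crossing_def doubleton_eq_iff by (metis open_segment_commute)
    also have "\<dots> \<longleftrightarrow> pos u < pos x \<and> pos x < pos v \<and> pos v < pos y \<or> pos x < pos u \<and> pos u < pos y \<and> pos y < pos v"
      using crossing_imp_interleaved[OF that(5,6) ne] interleaved_imp_crossing[of "pos u" "pos x" "pos v" "pos y"]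
        interleaved_imp_crossing[of "pos x" "pos u" "pos y" "pos v"]
      unfolding p_def comp_def by blast
    finally show ?thesis .
  qed
  define C where "C = E - sides p V"
  have C_diag: "C \<subseteq> diagonals p V"
    using pairs unfolding C_def diagonals_def by fastforce
  have nc: "noncrossing p C"
    unfolding noncrossing_def pairwise_def
  proof (intro ballI impI)
    fix e f assume "e \<in> C" "f \<in> C" "e \<noteq> f"
    moreover from this obtain u v x y where "u \<in> V" "v \<in> V" "x \<in> V" "y \<in> V" "e = {u, v}" "f = {x, y}"
      "pos u < pos v" "pos x < pos y" using pairs unfolding C_def by (metis DiffD1)
    ultimately show "\<not> crossing p e f"
      using crossing_iff planar unfolding C_def by (metis DiffD1)
  qed
  \<comment> \<open>A shortest edge spanning a missing diagonal has an apex strictly between the ends of the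
    diagonal, so one of the two sides at the apex crosses the diagonal.\<close>
  have max: "\<exists>c\<in>C. crossing p {x, y} c \<and> c \<noteq> {x, y}"
    if xy: "x \<in> V" "y \<in> V" "pos x < pos y" "{x, y} \<notin> E" for x y
  proof -
    define span where "span = (\<lambda>(u, v). u \<in> V \<and> v \<in> V \<and> {u, v} \<in> E \<and> pos u \<le> pos x \<and> pos y \<le> pos v)"
    obtain u0 v0 where "span (u0, v0)"
      using closing lt[OF xy(2)] unfolding span_def by fastforce
    then obtain uv where uv: "span uv"
      and least: "\<And>q. span q \<Longrightarrow> pos (snd uv) - pos (fst uv) \<le> pos (snd q) - pos (fst q)"
      using ex_has_least_nat[of span "(u0, v0)" "\<lambda>q. pos (snd q) - pos (fst q)"] by auto
    obtain u v where [simp]: "uv = (u, v)" by (cases uv)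
    have s: "u \<in> V" "v \<in> V" "{u, v} \<in> E" "pos u \<le> pos x" "pos y \<le> pos v"
      using uv by (auto simp: span_def)
    have "(pos u, pos v) \<noteq> (pos x, pos y)" using s xy inj by (auto dest: inj_onD)
    then have "Suc (pos u) < pos v" using s xy by auto
    then obtain t where t: "t \<in> V" "pos u < pos t" "pos t < pos v" "{u, t} \<in> E" "{t, v} \<in> E"
      using apex s by blast
    \<comment> \<open>If the apex were not strictly between \<open>x\<close> and \<open>y\<close>,
      then \<open>{u, t}\<close> or \<open>{t, v}\<close> would be a shorter spanning edge. As
      \<open>{u, v}\<close> differs from \<open>{x, y}\<close>, at least one of its ends lies
      strictly outside, and the edge from that end to \<open>t\<close> crosses.\<close>
    have "pos t < pos y" using least[of "(u, t)"] s t by (cases "pos t < pos y") (auto simp: span_def)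
    moreover have "pos x < pos t" using least[of "(t, v)"] s t by (cases "pos x < pos t") (auto simp: span_def)
    moreover have "pos u < pos x \<or> pos y < pos v" using \<open>_ \<noteq> _\<close> s by auto
    ultimately obtain a b where ab: "a \<in> V" "b \<in> V" "{a, b} \<in> E" "pos a < pos b"
      "pos a < pos x \<and> pos x < pos b \<and> pos b < pos y \<or> pos x < pos a \<and> pos a < pos y \<and> pos y < pos b"
      using s t by metis
    have "{x, y} \<noteq> {a, b}" using ab xy by auto
    moreover have "{a, b} \<notin> sides p V" using side_iff[OF ab(1,2,4)] ab(5) lt[OF xy(2)] by auto
    ultimately show ?thesis using crossing_iff[OF xy(1,2) ab(1,2) xy(3) ab(4)] ab C_def by blast
  qed
  have "C' = C" if C': "C \<subseteq> C'" "C' \<subseteq> diagonals p V" "noncrossing p C'" for C'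
  proof (rule ccontr)
    assume "C' \<noteq> C"
    then obtain e where e: "e \<in> C'" "e \<notin> C" using C' by blast
    then obtain x y where "x \<in> V" "y \<in> V" "x \<noteq> y" "e = {x, y}" "e \<notin> sides p V"
      using C'(2) by (auto simp: diagonals_def)
    moreover from this have "pos x < pos y \<or> pos y < pos x" using inj by (metis inj_onD nat_neq_iff)
    ultimately obtain x y where "x \<in> V" "y \<in> V" "pos x < pos y" "e = {x, y}" "e \<notin> sides p V"
      by (metis insert_commute)
    then obtain c where "c \<in> C" "crossing p e c" "c \<noteq> e" using max[of x y] e C_def by blast
    then show False using C' e(1) unfolding noncrossing_def pairwise_def by (metis subsetD)
  qed
  then have "maximal_noncrossing p V C" unfolding maximal_noncrossing_def using C_diag nc by auto
  then show ?thesis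
    unfolding maximal_outerplanar_def using placement side_edge by (auto simp: C_def intro!: exI[of _ p] exI[of _ C])
qed

section \<open>Fair domination and out-regular sets\<close>

text \<open>The neighbours of a vertex outside \<open>verts G - D\<close> are its neighbours in
  \<open>D\<close>. Equality of the counts is then fairness, and their positivity is
  domination.\<close>

lemma fair_dominating_set_iff_or_set:
  assumes "finite (verts G)"
  shows "fair_dominating_set G D \<longleftrightarrow> D \<subseteq> verts G \<and> or_set G (verts G - D)"
proof -
  have eq: "nbh G v - (verts G - D) = nbh G v \<inter> D" for v by (auto simp: nbh_def)
  have "card (nbh G v \<inter> D) > 0 \<longleftrightarrow> nbh G v \<inter> D \<noteq> {}" for v
    using assms by (simp add: card_gt_0_iff nbh_def)
  then show ?thesis
    unfolding fair_dominating_set_def dominating_set_def or_set_def eq by blast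
qed

lemma finite_or_set_cards:
  assumes "finite (verts G)"
  shows "finite {card Q | Q. or_set G Q}"
proof -
  have "{card Q | Q. or_set G Q} \<subseteq> card ` Pow (verts G)" by (auto simp: or_set_def)
  then show ?thesis using assms by (meson finite_Pow_iff finite_imageI finite_subset)
qed

lemma fd_eq_order_minus_xi_or:
  assumes fin: "finite (verts G)"
  shows "fd G = card (verts G) - xi_or G"
proof -
  have "{card Q | Q. or_set G Q} \<noteq> {}" by (auto simp: or_set_def intro!: exI[of _ "{}"])
  then obtain Q where Q: "or_set G Q" "card Q = xi_or G"
    using Max_in[OF finite_or_set_cards[OF fin]] unfolding xi_or_def by auto
  have QV: "Q \<subseteq> verts G" using Q by (simp add: or_set_def)
  have "fair_dominating_set G (verts G - Q)"
    using Q QV by (simp add: fair_dominating_set_iff_or_set[OF fin] double_diff)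
  moreover have "card (verts G - Q) = card (verts G) - xi_or G"
    using Q QV fin by (simp add: card_Diff_subset finite_subset)
  moreover have "card (verts G) - xi_or G \<le> card D" if D: "fair_dominating_set G D" for D
  proof -
    have *: "D \<subseteq> verts G" "or_set G (verts G - D)" using D by (auto simp: fair_dominating_set_iff_or_set[OF fin])
    then have "card (verts G - D) \<le> xi_or G"
      unfolding xi_or_def by (intro Max_ge finite_or_set_cards[OF fin]) auto
    then show ?thesis using * fin by (simp add: card_Diff_subset finite_subset)
  qed
  moreover have "finite {card D | D. fair_dominating_set G D}"
  proof (rule finite_subset)
    show "{card D | D. fair_dominating_set G D} \<subseteq> card ` Pow (verts G)"
      by (auto simp: fair_dominating_set_iff_or_set[OF fin])
  qed (use fin in simp)
  ultimately show ?thesis unfolding fd_def by (intro Min_eqI) (auto, metis)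
qed

section \<open>Edges and vertices of the graph H m\<close>

text \<open>The side \<open>{0, 10}\<close> is included: in every copy but the first it is a diagonal of the whole
  polygon, with apex 1.\<close>

definition Gamma_chords :: "(nat \<times> nat) set" where
  "Gamma_chords = {(1, 10), (2, 4), (2, 10), (4, 8), (4, 9), (4, 10), (5, 8), (6, 8), (0, 10)}"

lemma Gamma_edges_eq: "Gamma_edges = {{j, Suc j} | j. j \<le> 9} \<union> (\<lambda>(a, b). {a, b}) ` Gamma_chords"
  by (simp add: Gamma_edges_def Gamma_chords_def insert_commute[of 10])

lemma Gamma_edge_iff:
  "{a, b} \<in> Gamma_edges \<longleftrightarrow> b = Suc a \<and> a \<le> 9 \<or> a = Suc b \<and> b \<le> 9 \<or>
    (a, b) \<in> Gamma_chords \<or> (b, a) \<in> Gamma_chords"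
proof -
  have "{a, b} \<in> {{j, Suc j} | j. j \<le> 9} \<longleftrightarrow> b = Suc a \<and> a \<le> 9 \<or> a = Suc b \<and> b \<le> 9"
    by (auto simp: doubleton_eq_iff)
  moreover have "{a, b} \<in> (\<lambda>(c, d). {c, d}) ` Gamma_chords \<longleftrightarrow> (a, b) \<in> Gamma_chords \<or> (b, a) \<in> Gamma_chords"
    by (auto simp: doubleton_eq_iff image_iff)
  ultimately show ?thesis by (simp add: Gamma_edges_eq)
qed

lemma Gamma_edgeE:
  assumes "e \<in> Gamma_edges"
  obtains a b where "a < b" "b \<le> 10" "e = {a, b}"
proof -
  from assms consider j where "j \<le> 9" "e = {j, Suc j}" | a b where "(a, b) \<in> Gamma_chords" "e = {a, b}"
    by (auto simp: Gamma_edges_eq)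
  then show thesis
  proof cases
    case 1
    then show thesis using that[of j "Suc j"] by simp
  next
    case 2
    then have "a < b \<and> b \<le> 10" by (auto simp: Gamma_chords_def)
    then show thesis using that 2 by blast
  qed
qed

lemma w_inner [simp]: "0 < j \<Longrightarrow> j \<noteq> 10 \<Longrightarrow> w i j = (i, j)"
  by (simp add: w_def)

lemma w_0 [simp]: "w 0 j = (0, j)"
  by (simp add: w_def)

lemma w_Suc_0 [simp]: "w (Suc i) 0 = (i, 5)"
  by (simp add: w_def)

lemma w_Suc_10 [simp]: "w (Suc i) 10 = (i, 6)"
  by (simp add: w_def)

lemma w_in_verts: "i < m \<Longrightarrow> j \<le> 10 \<Longrightarrow> w i j \<in> verts (H m)"
  by (auto simp: H_def)

lemma verts_H:
  assumes "0 < m"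
  shows "verts (H m) = insert (0, 0) (insert (0, 10) ({..<m} \<times> {1..9}))"
proof
  show "verts (H m) \<subseteq> insert (0, 0) (insert (0, 10) ({..<m} \<times> {1..9}))"
    by (auto simp: H_def w_def)
  have "(i, j) \<in> verts (H m)" if "i < m" "j \<in> {1..9}" for i j
    using that w_in_verts[of i m j] by simp
  moreover have "(0, 0) \<in> verts (H m)" "(0, 10) \<in> verts (H m)"
    using assms w_in_verts[of 0 m 0] w_in_verts[of 0 m 10] by simp_all
  ultimately show "insert (0, 0) (insert (0, 10) ({..<m} \<times> {1..9})) \<subseteq> verts (H m)" by auto
qed

lemma sum_verts_H:
  fixes f :: "nat \<times> nat \<Rightarrow> 'a::comm_monoid_add"
  assumes "0 < m"
  shows "sum f (verts (H m)) = f (0, 0) + f (0, 10) + (\<Sum>i<m. \<Sum>j\<in>{1..9}. f (i, j))"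
  unfolding verts_H[OF assms] by (simp add: sum.cartesian_product add.assoc)

lemma finite_verts_H: "0 < m \<Longrightarrow> finite (verts (H m))"
  by (simp add: verts_H)

lemma card_verts_H: "0 < m \<Longrightarrow> card (verts (H m)) = 9 * m + 2"
  by (simp add: card_eq_sum sum_verts_H del: sum_constant) simp

lemma edges_HE:
  assumes "e \<in> edges (H m)"
  obtains i a b where "i < m" "a < b" "b \<le> 10" "{a, b} \<in> Gamma_edges" "e = {w i a, w i b}"
proof -
  from assms obtain i e' where *: "i < m" "e' \<in> Gamma_edges" "e = w i ` e'" by (auto simp: H_def)
  from Gamma_edgeE[OF *(2)] obtain a b where "a < b" "b \<le> 10" "e' = {a, b}" .
  with * that show thesis by auto
qed

lemma edges_HI: "i < m \<Longrightarrow> {a, b} \<in> Gamma_edges \<Longrightarrow> {w i a, w i b} \<in> edges (H m)"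
  unfolding H_def by (auto intro!: exI[of _ i] exI[of _ "{a, b}"])

section \<open>The polygon around the graph H m\<close>

text \<open>The outer cycle runs through the labels 0 to 5 of the copies in increasing order
  (positions 0 to \<open>5 * m\<close>) and returns through the labels 6 to 10 in decreasing order
  of copies (positions \<open>5 * m + 1\<close> to \<open>9 * m + 1\<close>). For
  \<open>i < m\<close> the truncated subtraction is exact.\<close>

fun position :: "nat \<Rightarrow> nat \<times> nat \<Rightarrow> nat" where
  "position m (i, j) = (if j \<le> 5 then 5 * i + j else 9 * m + j - 4 * i - 9)"

text \<open>Both names of a glued vertex give the same value, so the formula applies to every label
  of every copy without treating the identifications separately.\<close>

lemma position_w:
  "i < m \<Longrightarrow> j \<le> 10 \<Longrightarrow> position m (w i j) = (if j \<le> 5 then 5 * i + j else 9 * m + j - 4 * i - 9)"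
  by (auto simp: w_def)

lemma position_less_iff:
  "i < m \<Longrightarrow> a \<le> 10 \<Longrightarrow> b \<le> 10 \<Longrightarrow> position m (w i a) < position m (w i b) \<longleftrightarrow> a < b"
  by (auto simp: position_w)

lemma inj_position:
  assumes "0 < m"
  shows "inj_on (position m) (verts (H m))"
proof (rule inj_onI)
  fix u v assume uv: "u \<in> verts (H m)" "v \<in> verts (H m)" "position m u = position m v"
  obtain i j i' j' where [simp]: "u = (i, j)" "v = (i', j')" by (metis surj_pair)
  have u: "i < m" "1 \<le> j \<or> i = 0" "j \<le> 9 \<or> i = 0"
    and v: "i' < m" "1 \<le> j' \<or> i' = 0" "j' \<le> 9 \<or> i' = 0"
    using uv assms by (auto simp: verts_H)
  \<comment> \<open>The outward run ends at \<open>5 * m\<close> and the return run begins at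
    \<open>5 * m + 1\<close>.\<close>
  have sep: "5 * x + y < 9 * m + y' - 4 * x' - 9" if "x < m" "x' < m" "y \<le> 5" "5 < y'" for x x' y y' :: nat
    using that by linarith
  have "i = i' \<and> j = j'"
  proof (cases "j \<le> 5"; cases "j' \<le> 5")
    assume jj: "j \<le> 5" "j' \<le> 5"
    then have "5 * i + j = 5 * i' + j'" using uv(3) by simp
    then show ?thesis using u(2) v(2) jj by (cases i i' rule: linorder_cases) linarith+
  next
    assume jj: "\<not> j \<le> 5" "\<not> j' \<le> 5"
    then have "j + 4 * i' = j' + 4 * i" using uv(3) u(1) v(1) by simp
    then show ?thesis using u(3) v(3) jj by (cases i i' rule: linorder_cases) linarith+
  qed (use uv(3) u(1) v(1) sep[of i i' j j'] sep[of i' i j' j] in simp_all)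
  then show "u = v" by simp
qed

lemma bij_position:
  assumes "0 < m"
  shows "bij_betw (position m) (verts (H m)) {..<9 * m + 2}"
proof -
  have "position m ` verts (H m) \<subseteq> {..<9 * m + 2}"
    unfolding verts_H[OF assms] by (auto split: if_splits)
  then have "position m ` verts (H m) = {..<9 * m + 2}"
    using card_image[OF inj_position[OF assms]] card_verts_H[OF assms]
    by (intro card_subset_eq) auto
  then show ?thesis using inj_position[OF assms] by (simp add: bij_betw_def)
qed

lemma oriented_edge:
  assumes "{u, v} \<in> edges (H m)" "position m u < position m v"
  obtains i a b where "i < m" "a < b" "b \<le> 10" "{a, b} \<in> Gamma_edges" "u = w i a" "v = w i b"
proof -
  from edges_HE[OF assms(1)] obtain i a b where
    *: "i < m" "a < b" "b \<le> 10" "{a, b} \<in> Gamma_edges" "{u, v} = {w i a, w i b}" .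
  then have "u = w i a \<and> v = w i b"
    using assms(2) position_less_iff[of i m b a] by (auto simp: doubleton_eq_iff)
  with * that show thesis by blast
qed

lemma H_path:
  assumes "0 < m" "Suc k < 9 * m + 2"
  shows "\<exists>u\<in>verts (H m). \<exists>v\<in>verts (H m).
    position m u = k \<and> position m v = Suc k \<and> {u, v} \<in> edges (H m)"
proof -
  have "\<exists>i<m. \<exists>a\<le>9. position m (w i a) = k \<and> position m (w i (Suc a)) = Suc k"
  proof -
    consider "k < 5 * m" | "k = 5 * m" | "5 * m < k" by linarith
    then show ?thesis
    proof cases
      case 1
      then show ?thesis
        by (intro exI[of _ "k div 5"] conjI exI[of _ "k mod 5"]) (auto simp: position_w)
    next
      case 2
      then show ?thesis using assms
        by (intro exI[of _ "m - 1"] conjI exI[of _ "5"]) (auto simp: position_w simp del: w_inner)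
    next
      case 3
      \<comment> \<open>The return run has four sides per copy and visits the copies backwards, so
        it is divided by 4 counting from its far end.\<close>
      define t where "t = 9 * m - k"
      have "t < 4 * m" "k = 9 * m - t" using 3 assms by (auto simp: t_def)
      moreover have "t = 4 * (t div 4) + t mod 4" "t mod 4 < 4" by auto
      ultimately show ?thesis
        by (intro exI[of _ "t div 4"] conjI exI[of _ "9 - t mod 4"]) (auto simp: position_w simp del: w_inner)
    qed
  qed
  then obtain i a where ia: "i < m" "a \<le> 9" "position m (w i a) = k" "position m (w i (Suc a)) = Suc k"
    by blast
  then have "{w i a, w i (Suc a)} \<in> edges (H m)" by (intro edges_HI) (auto simp: Gamma_edge_iff)
  then show ?thesis using ia w_in_verts[of i m a] w_in_verts[of i m "Suc a"] by auto
qed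

lemma Gamma_planar:
  assumes "{a, b} \<in> Gamma_edges" "{c, d} \<in> Gamma_edges" "a < c" "c < b" "b < d"
  shows False
  using assms unfolding Gamma_edge_iff Gamma_chords_def by auto

text \<open>All copies after copy \<open>i\<close> occupy positions between those of its labels 5
  and 6, and no vertex of copy \<open>i\<close> lies strictly between these. Hence edges of
  different copies cannot interleave, and a single copy is a finite check.\<close>

lemma H_planar:
  assumes "{u, v} \<in> edges (H m)" "{x, y} \<in> edges (H m)"
  shows "\<not> (position m u < position m x \<and> position m x < position m v \<and> position m v < position m y)"
proof
  assume lt: "position m u < position m x \<and> position m x < position m v \<and> position m v < position m y"
  then have "position m u < position m v" "position m x < position m y" by linarith+
  then obtain i a b i' c d where uv: "i < m" "a < b" "b \<le> 10" "{a, b} \<in> Gamma_edges" "u = w i a" "v = w i b"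
    and xy: "i' < m" "c < d" "d \<le> 10" "{c, d} \<in> Gamma_edges" "x = w i' c" "y = w i' d"
    using oriented_edge[OF assms(1)] oriented_edge[OF assms(2)] by metis
  show False
  proof (cases "i = i'")
    case True
    then show False using lt uv xy Gamma_planar[of a b c d] by (simp add: position_less_iff)
  next
    case False
    then have "Suc i \<le> i' \<or> Suc i' \<le> i" by linarith
    then show False using lt uv xy by (auto simp: position_w split: if_splits)
  qed
qed

lemma Gamma_apex:
  assumes "(a, b) \<in> Gamma_chords"
  shows "\<exists>t. a < t \<and> t < b \<and> {a, t} \<in> Gamma_edges \<and> {t, b} \<in> Gamma_edges"
proof -
  have "\<exists>t\<in>{1, 2, 3, 4, 5, 6, 7, 8, 9}. a < t \<and> t < b \<and> {a, t} \<in> Gamma_edges \<and> {t, b} \<in> Gamma_edges"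
    using assms unfolding Gamma_chords_def insert_iff empty_iff
    by (elim disjE; simp add: Gamma_edge_iff; simp add: Gamma_chords_def)
  then show ?thesis by blast
qed

lemma H_apex:
  assumes "{u, v} \<in> edges (H m)" "Suc (position m u) < position m v"
  shows "\<exists>t\<in>verts (H m). position m u < position m t \<and> position m t < position m v \<and>
    {u, t} \<in> edges (H m) \<and> {t, v} \<in> edges (H m)"
proof -
  from assms(2) have "position m u < position m v" by simp
  from oriented_edge[OF assms(1) this] obtain i a b where
    uv: "i < m" "a < b" "b \<le> 10" "{a, b} \<in> Gamma_edges" "u = w i a" "v = w i b" .
  have apex: ?thesis if ia: "i < m" "(a, b) \<in> Gamma_chords" "u = w i a" "v = w i b" for i a b
  proof -
    have "b \<le> 10" using ia(2) by (auto simp: Gamma_chords_def)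
    obtain t where "a < t" "t < b" "{a, t} \<in> Gamma_edges" "{t, b} \<in> Gamma_edges"
      using Gamma_apex[OF ia(2)] by blast
    then show ?thesis using ia \<open>b \<le> 10\<close> edges_HI
      by (intro bexI[of _ "w i t"] w_in_verts) (auto simp: position_less_iff simp del: w_inner)
  qed
  show ?thesis
  proof (cases "(a, b) \<in> Gamma_chords")
    case True
    show ?thesis using apex[OF uv(1) True uv(5,6)] .
  next
    case False
    moreover have "(b, a) \<notin> Gamma_chords" using uv(2) by (auto simp: Gamma_chords_def)
    ultimately have b: "b = Suc a" "a \<le> 9" using uv(2,4) by (simp_all add: Gamma_edge_iff)
    \<comment> \<open>Consecutive labels have non-consecutive positions only at a glued edge, which
      is the chord \<open>{0, 10}\<close> of the next copy.\<close>
    then have "a = 5" "Suc i < m"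
      using assms(2) uv by (auto simp: position_w split: if_splits simp del: w_inner)
    then show ?thesis
      using apex[of "Suc i" 0 10] uv b by (simp add: Gamma_chords_def)
  qed
qed

lemma maximal_outerplanar_H:
  assumes "0 < m"
  shows "maximal_outerplanar (H m)"
proof -
  have "maximal_outerplanar (verts (H m), edges (H m))"
  proof (rule maximal_outerplanarI[OF bij_position[OF assms]])
    show "3 \<le> 9 * m + 2" using assms by simp
    show "\<exists>u\<in>verts (H m). \<exists>v\<in>verts (H m). e = {u, v} \<and> position m u < position m v"
      if "e \<in> edges (H m)" for e
    proof -
      from edges_HE[OF that] obtain i a b where
        "i < m" "a < b" "b \<le> 10" "{a, b} \<in> Gamma_edges" "e = {w i a, w i b}" .
      then show ?thesis using position_less_iff[of i m a b]
        by (intro bexI[of _ "w i a"] bexI[of _ "w i b"] w_in_verts) auto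
    qed
    have "{w 0 0, w 0 10} \<in> edges (H m)"
      using assms by (intro edges_HI) (auto simp: Gamma_edge_iff Gamma_chords_def)
    then show "\<exists>u\<in>verts (H m). \<exists>v\<in>verts (H m).
        position m u = 0 \<and> position m v = 9 * m + 2 - 1 \<and> {u, v} \<in> edges (H m)"
      using assms by (intro bexI[of _ "(0, 0)"] bexI[of _ "(0, 10)"]) (auto simp: verts_H)
  qed (fact H_path[OF assms] H_planar H_apex)+
  then show ?thesis by simp
qed

section \<open>Neighborhoods in the graph H m\<close>

text \<open>The union ranges over all names \<open>(i, a)\<close> of \<open>v\<close>. There are two
  for a glued vertex and one otherwise, so each neighborhood reduces to finding the names.\<close>

lemma nbh_H:
  "nbh (H m) v = (\<Union>i\<in>{..<m}. \<Union>a\<in>{a. w i a = v}. w i ` {b. {b, a} \<in> Gamma_edges})"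
proof (intro set_eqI iffI)
  fix u assume "u \<in> nbh (H m) v"
  then have "{u, v} \<in> edges (H m)" by (simp add: nbh_def)
  from edges_HE[OF this] obtain i a b where *: "i < m" "{a, b} \<in> Gamma_edges" "{u, v} = {w i a, w i b}" .
  then have "u = w i a \<and> v = w i b \<or> u = w i b \<and> v = w i a" by (simp add: doubleton_eq_iff)
  moreover have "{b, a} \<in> Gamma_edges" using *(2) by (simp add: insert_commute)
  ultimately show "u \<in> (\<Union>i\<in>{..<m}. \<Union>a\<in>{a. w i a = v}. w i ` {b. {b, a} \<in> Gamma_edges})"
    using *(1,2) by blast
next
  fix u assume "u \<in> (\<Union>i\<in>{..<m}. \<Union>a\<in>{a. w i a = v}. w i ` {b. {b, a} \<in> Gamma_edges})"
  then obtain i a b where *: "i < m" "w i a = v" "u = w i b" "{b, a} \<in> Gamma_edges" by auto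
  moreover have "b \<le> 10" using *(4) by (auto elim!: Gamma_edgeE simp: doubleton_eq_iff)
  ultimately show "u \<in> nbh (H m) v"
    using w_in_verts[of i m b] edges_HI[of i m b a] by (simp add: nbh_def)
qed

lemma Gamma_nbh:
  "{b. {b, 0} \<in> Gamma_edges} = {1, 10}"
  "{b. {b, 1} \<in> Gamma_edges} = {0, 2, 10}"
  "{b. {b, 2} \<in> Gamma_edges} = {1, 3, 4, 10}"
  "{b. {b, 3} \<in> Gamma_edges} = {2, 4}"
  "{b. {b, 4} \<in> Gamma_edges} = {2, 3, 5, 8, 9, 10}"
  "{b. {b, 5} \<in> Gamma_edges} = {4, 6, 8}"
  "{b. {b, 6} \<in> Gamma_edges} = {5, 7, 8}"
  "{b. {b, 7} \<in> Gamma_edges} = {6, 8}"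
  "{b. {b, 8} \<in> Gamma_edges} = {4, 5, 6, 7, 9}"
  "{b. {b, 9} \<in> Gamma_edges} = {4, 8, 10}"
  "{b. {b, 10} \<in> Gamma_edges} = {0, 1, 2, 4, 9}"
  unfolding Gamma_edge_iff Gamma_chords_def
  by (auto simp del: One_nat_def)

lemma nbh_H_inner:
  assumes "i < m" "j \<in> {1, 2, 3, 4, 7, 8, 9}"
  shows "nbh (H m) (i, j) = w i ` {b. {b, j} \<in> Gamma_edges}"
proof -
  have "w i' a = (i, j) \<longleftrightarrow> i' = i \<and> a = j" for i' a
    using assms(2) by (auto simp: w_def)
  then show ?thesis using assms(1) by (auto simp: nbh_H)
qed

lemma nbh_H_start:
  assumes "0 < m" "j \<in> {0, 10}"
  shows "nbh (H m) (0, j) = w 0 ` {b. {b, j} \<in> Gamma_edges}"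
proof -
  have "w i a = (0, j) \<longleftrightarrow> i = 0 \<and> a = j" for i a
    using assms(2) by (auto simp: w_def)
  then show ?thesis using assms(1) by (auto simp: nbh_H)
qed

lemma nbh_H_glued:
  assumes "i < m" "(j, j') \<in> {(5, 0), (6, 10)}"
  shows "nbh (H m) (i, j) = w i ` {b. {b, j} \<in> Gamma_edges} \<union>
    (if Suc i < m then w (Suc i) ` {b. {b, j'} \<in> Gamma_edges} else {})"
proof -
  have "w i' a = (i, j) \<longleftrightarrow> i' = i \<and> a = j \<or> i' = Suc i \<and> a = j'" for i' a
    using assms(2) by (cases i') (auto simp: w_def)
  then show ?thesis using assms(1) by (auto simp: nbh_H)
qed

text \<open>The order of the lists is that of the premises of \<open>potential_step\<close> below.\<close>

lemma nbh_H_lists: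
  shows "i < m \<Longrightarrow> nbh (H m) (i, 1) = set [w i 10, w i 2, w i 0]"
    and "i < m \<Longrightarrow> nbh (H m) (i, 2) = set [w i 4, w i 10, w i 3, w i 1]"
    and "i < m \<Longrightarrow> nbh (H m) (i, 3) = set [w i 4, w i 2]"
    and "i < m \<Longrightarrow> nbh (H m) (i, 4) = set [w i 8, w i 9, w i 10, w i 2, w i 3, w i 5]"
    and "i < m \<Longrightarrow> nbh (H m) (i, 7) = set [w i 8, w i 6]"
    and "i < m \<Longrightarrow> nbh (H m) (i, 8) = set [w i 4, w i 5, w i 6, w i 7, w i 9]"
    and "i < m \<Longrightarrow> nbh (H m) (i, 9) = set [w i 8, w i 4, w i 10]"
    and "0 < m \<Longrightarrow> nbh (H m) (0, 0) = set [w 0 10, w 0 1]"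
    and "0 < m \<Longrightarrow> nbh (H m) (0, 10) = set [w 0 4, w 0 9, w 0 2, w 0 1, w 0 0]"
    and "Suc i < m \<Longrightarrow> nbh (H m) (i, 5) = set [w i 4, w i 8, w (Suc i) 10, w (Suc i) 1]"
    and "Suc i < m \<Longrightarrow> nbh (H m) (i, 6) =
      set [w i 7, w i 8, w (Suc i) 4, w (Suc i) 9, w (Suc i) 2, w (Suc i) 1, w (Suc i) 0]"
    and "Suc i = m \<Longrightarrow> nbh (H m) (i, 5) = set [w i 4, w i 8, w i 6]"
    and "Suc i = m \<Longrightarrow> nbh (H m) (i, 6) = set [w i 7, w i 8, w i 5]"
  using nbh_H_glued[of i m 5 0] nbh_H_glued[of i m 6 10]
  by (auto simp: nbh_H_inner nbh_H_start Gamma_nbh simp flip: One_nat_def)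

lemma verts_H_cases:
  assumes "v \<in> verts (H m)"
  obtains "0 < m" "v = (0, 0)" | "0 < m" "v = (0, 10)"
    | i j where "i < m" "j \<in> {1, 2, 3, 4, 7, 8, 9}" "v = (i, j)"
    | i j where "Suc i < m" "j \<in> {5, 6}" "v = (i, j)"
    | i j where "Suc i = m" "j \<in> {5, 6}" "v = (i, j)"
proof -
  have m: "0 < m" using assms by (auto simp: H_def)
  have nine: "{1..9} = {1, 2, 3, 4, 7, 8, 9} \<union> {5, 6 :: nat}" by auto
  from assms consider "v = (0, 0)" | "v = (0, 10)" | i j where "i < m" "j \<in> {1..9}" "v = (i, j)"
    unfolding verts_H[OF m] by blast
  then show thesis
  proof cases
    case (3 i j)
    then have "j \<in> {1, 2, 3, 4, 7, 8, 9} \<or> j \<in> {5, 6}" unfolding nine by blast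
    moreover have "Suc i < m \<or> Suc i = m" using 3 by linarith
    ultimately show thesis using that(3)[OF 3(1) _ 3(3)] that(4,5)[OF _ _ 3(3)] by blast
  qed (use m that in blast)+
qed

lemma card_nbh_H_le:
  assumes "v \<in> verts (H m)"
  shows "card (nbh (H m) v) \<le> 7"
proof -
  have le: "card S \<le> 7" if "S = set xs" "length xs \<le> 7" for S and xs :: "(nat \<times> nat) list"
    using that card_length[of xs] by simp
  note bounds = nbh_H_lists[THEN le]
  show ?thesis
    using assms
  proof (cases rule: verts_H_cases)
    case 1
    then show ?thesis using bounds(8) by simp
  next
    case 2
    then show ?thesis using bounds(9) by simp
  next
    case (3 i j)
    then show ?thesis using bounds(1-7)[OF 3(1)] by auto
  next
    case (4 i j)
    then show ?thesis using bounds(10,11)[OF 4(1)] by auto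
  next
    case (5 i j)
    then show ?thesis using bounds(12,13)[OF 5(1)] by auto
  qed
qed

lemma max_degree_H:
  assumes "2 \<le> m"
  shows "max_degree (H m) = 7"
proof -
  \<comment> \<open>This vertex is also \<open>w 1 10\<close> and collects neighbours from two
    copies; hence the assumption \<open>2 \<le> m\<close>.\<close>
  have "(0, 6) \<in> verts (H m)" using assms by (auto simp: verts_H)
  moreover have "card (nbh (H m) (0, 6)) = 7"
    using assms by (subst nbh_H_lists(11)) (auto simp: card_insert_if)
  ultimately show ?thesis
    unfolding max_degree_def using card_nbh_H_le finite_verts_H[of m] assms
    by (intro Max_eqI) (auto intro!: image_eqI[of 7 _ "(0, 6)"])
qed

section \<open>Out-regular sets of the graph H m\<close>

text \<open>Scanning the copies from left to right with a set whose members all have \<open>k\<close> outside neighbours,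
  the state at a glued edge consists of two options, one for \<open>w\<^sub>5\<close> and one for \<open>w\<^sub>6\<close>:
  \<open>None\<close> if the vertex is not in the set, and \<open>Some c\<close> if it is and has \<open>c\<close> outside neighbours in
  the copies scanned so far, not counting its partner on the glued edge. The table is a solution of
  the difference constraints stated in \<open>potential_start\<close>, \<open>potential_step\<close> and \<open>potential_end\<close>,
  obtained from longest paths in the transition graph; the default \<open>-3\<close> only concerns states from
  which no admissible final state can be reached.\<close>

definition potential :: "nat \<Rightarrow> nat option \<Rightarrow> nat option \<Rightarrow> int" where
  "potential k s t =
    (if (k, s, t) \<in> {(2, Some 1, None)} then 2
     else if (k, s, t) \<in> {(2, None, None), (2, Some 0, None), (3, None, None)} then 1
     else if (k, s, t) \<in> {(1, None, None), (1, Some 0, None), (1, None, Some 0), (1, Some 1, Some 1),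
       (2, Some 2, Some 2), (2, Some 1, Some 0), (2, None, Some 1),
       (3, Some 2, Some 0), (3, Some 1, None), (3, Some 2, None), (3, None, Some 2),
       (4, None, Some 0), (4, None, None), (5, None, None), (6, None, None), (7, None, None)} then 0
     else if (k, s, t) \<in> {(4, Some 2, None), (5, None, Some 0), (5, None, Some 1)} then -1
     else if (k, s, t) \<in> {(6, None, Some 1), (7, None, Some 2)} then -2
     else -3)"

text \<open>Counting outside neighbours on Boolean lists turns the local conditions into finitely
  many propositional cases. By default a count unfolds only where an entry is already known.\<close>

primrec outs :: "bool list \<Rightarrow> nat" where
  "outs [] = 0"
| "outs (b # bs) = of_bool (\<not> b) + outs bs"

declare outs.simps(2) [simp del]

lemma outs_Cons [simp]: "outs (True # bs) = outs bs" "outs (False # bs) = Suc (outs bs)"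
  by (simp_all add: outs.simps)

lemma card_diff_eq_outs:
  assumes "distinct xs"
  shows "card (set xs - Q) = outs (map (\<lambda>x. x \<in> Q) xs)"
  using assms by (induction xs) (auto simp: insert_Diff_if)

text \<open>Nothing has been scanned before copy 0, so both counts are 0. The additive constant of
  the bound \<open>2 * m + 2\<close> is spent here.\<close>

lemma potential_start:
  assumes "k \<in> {1, 2, 3, 4, 5, 6, 7}"
  shows "of_bool a + of_bool b + potential k (if a then Some 0 else None) (if b then Some 0 else None) \<le> 2"
  using assms by (cases a; cases b) (auto simp: potential_def)

text \<open>After the last copy the only neighbour of each end of the edge not yet counted is its
  partner, so the premises describe exactly the admissible final states.\<close>

lemma potential_end:
  assumes "k \<in> {1, 2, 3, 4, 5, 6, 7}"
    and "a \<longrightarrow> x + outs [b] = k" "b \<longrightarrow> y + outs [a] = k" "x \<in> {0, 1, 2}" "y \<in> {0, 1, 2}"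
  shows "potential k (if a then Some x else None) (if b then Some y else None) \<ge> 0"
  using assms by (cases a; cases b) (auto simp: potential_def)

text \<open>Here \<open>p\<^sub>j\<close> says that \<open>w\<^sub>j\<close> of the current copy belongs to the set.\<close>

lemma potential_step:
  assumes k: "k \<in> {1,2,3,4,5,6,7}"
    and "p8 \<longrightarrow> outs [p4, p5, p6, p7, p9] = k"
    and "p4 \<longrightarrow> outs [p8, p9, p10, p2, p3, p5] = k"
    and "p7 \<longrightarrow> outs [p8, p6] = k"
    and "p3 \<longrightarrow> outs [p4, p2] = k"
    and "p9 \<longrightarrow> outs [p8, p4, p10] = k"
    and "p2 \<longrightarrow> outs [p4, p10, p3, p1] = k"
    and "p1 \<longrightarrow> outs [p10, p2, p0] = k"
    and "p0 \<longrightarrow> x + outs [p10, p1] = k" and "x \<in> {0, 1, 2}"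
    and "p10 \<longrightarrow> y + outs [p4, p9, p2, p1, p0] = k"
  shows "of_bool p1 + of_bool p2 + of_bool p3 + of_bool p4 + of_bool p5 + of_bool p6 + of_bool p7
     + of_bool p8 + of_bool p9
     + potential k (if p5 then Some (outs [p4, p8]) else None) (if p6 then Some (outs [p7, p8]) else None)
     \<le> 2 + potential k (if p0 then Some x else None) (if p10 then Some y else None)"
proof -
  \<comment> \<open>Discarding impossible cases between the case splits keeps the search small.\<close>
  note pruning = outs.simps(1) outs_Cons simp_thms nat.inject nat.distinct
  \<comment> \<open>\<open>outs_Cons\<close> produces counts in \<open>Suc\<close> form, and
    \<open>k\<close> must match for \<open>pruning\<close> to refute unequal counts.\<close>
  have "k = Suc 0 \<or> k = Suc (Suc 0) \<or> k = Suc (Suc (Suc 0)) \<or> k = Suc (Suc (Suc (Suc 0))) \<or>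
      k = Suc (Suc (Suc (Suc (Suc 0)))) \<or> k = Suc (Suc (Suc (Suc (Suc (Suc 0))))) \<or>
      k = Suc (Suc (Suc (Suc (Suc (Suc (Suc 0))))))"
    using k by auto
  then show ?thesis
    using assms(2-)
    \<comment> \<open>The splits are ordered to complete neighborhoods early: that of 9 after
      \<open>p10\<close> and \<open>p2\<close>, those of 3 and 4 after \<open>p3\<close> and
      \<open>p5\<close>, those of 7 and 8 after \<open>p6\<close> and \<open>p7\<close>, those of 1
      and 2 at the end.\<close>
    by - (elim disjE; hypsubst; cases p8; cases p4; cases p9; (simp only: pruning; fail)?;
        cases p10; cases p2; (simp only: pruning; fail)?;
        cases p3; cases p5; (simp only: pruning; fail)?;
        cases p6; cases p7; (simp only: pruning; fail)?;
        cases p1; cases p0; (simp only: pruning; fail)?;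
        simp add: potential_def)
qed

text \<open>The inequalities \<open>c i + \<Phi> (Suc i) \<le> 2 + \<Phi> i\<close> telescope, and
  the constraints at both ends bound what remains. Since \<open>c i\<close> counts the labels 1 to
  9, a glued vertex is counted once, in its lower copy, and only the labels 0 and 10 of copy 0 are
  left over.\<close>

lemma card_le_of_uniform_or_set:
  assumes m: "0 < m" and k: "k \<in> {1, 2, 3, 4, 5, 6, 7}" and Q: "Q \<subseteq> verts (H m)"
    and reg: "\<And>v. v \<in> Q \<Longrightarrow> card (nbh (H m) v - Q) = k"
  shows "card Q \<le> 2 * m + 2"
proof -
  define q where "q i j \<longleftrightarrow> w i j \<in> Q" for i j
  \<comment> \<open>The counts contributed by the preceding copy to the labels 0 and 10 of copy
    \<open>i\<close>; the glued edge itself is left to copy \<open>i\<close>, where it is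
    \<open>{0, 10}\<close>.\<close>
  define x where "x i = (case i of 0 \<Rightarrow> 0 | Suc l \<Rightarrow> outs [q l 4, q l 8])" for i
  define y where "y i = (case i of 0 \<Rightarrow> 0 | Suc l \<Rightarrow> outs [q l 7, q l 8])" for i
  \<comment> \<open>This is meaningful for \<open>i = m\<close> too: \<open>w m 0\<close> and
    \<open>w m 10\<close> are the labels 5 and 6 of the last copy, so \<open>\<Phi> m\<close>
    belongs to the final state.\<close>
  define \<Phi> where "\<Phi> i = potential k (if q i 0 then Some (x i) else None) (if q i 10 then Some (y i) else None)" for i
  define c where "c i = (\<Sum>j\<in>{1..9}. of_bool (q i j) :: int)" for i
  have q_Suc: "q (Suc i) 0 = q i 5" "q (Suc i) 10 = q i 6" for i by (simp_all add: q_def)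
  have xy: "x i \<in> {0, 1, 2}" "y i \<in> {0, 1, 2}" for i
    by (auto simp: x_def y_def outs.simps split: nat.splits)
  have count: "outs (map (\<lambda>u. u \<in> Q) xs) = k" if "v \<in> Q" "nbh (H m) v = set xs" "distinct xs" for v xs
    using reg[OF that(1)] that(2) card_diff_eq_outs[OF that(3), of Q] by simp
  have inner: "q i 8 \<longrightarrow> outs [q i 4, q i 5, q i 6, q i 7, q i 9] = k"
      "q i 4 \<longrightarrow> outs [q i 8, q i 9, q i 10, q i 2, q i 3, q i 5] = k"
      "q i 7 \<longrightarrow> outs [q i 8, q i 6] = k"
      "q i 3 \<longrightarrow> outs [q i 4, q i 2] = k"
      "q i 9 \<longrightarrow> outs [q i 8, q i 4, q i 10] = k"
      "q i 2 \<longrightarrow> outs [q i 4, q i 10, q i 3, q i 1] = k"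
      "q i 1 \<longrightarrow> outs [q i 10, q i 2, q i 0] = k" if "i < m" for i
    using count[OF _ nbh_H_lists(1)[OF that]] count[OF _ nbh_H_lists(2)[OF that]]
      count[OF _ nbh_H_lists(3)[OF that]] count[OF _ nbh_H_lists(4)[OF that]]
      count[OF _ nbh_H_lists(5)[OF that]] count[OF _ nbh_H_lists(6)[OF that]]
      count[OF _ nbh_H_lists(7)[OF that]]
    by (simp_all add: q_def w_eq_iff del: w_inner) simp_all
  have left: "q i 0 \<longrightarrow> x i + outs [q i 10, q i 1] = k" if "i < m" for i
  proof (cases i)
    case 0
    then show ?thesis using count[OF _ nbh_H_lists(8)[OF m]] by (simp add: q_def x_def)
  next
    case (Suc l)
    with that have "Suc l < m" by simp
    from count[OF _ nbh_H_lists(10)[OF this]] show ?thesis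
      by (simp add: Suc q_def x_def outs.simps add_ac)
  qed
  have right: "q i 10 \<longrightarrow> y i + outs [q i 4, q i 9, q i 2, q i 1, q i 0] = k" if "i < m" for i
  proof (cases i)
    case 0
    then show ?thesis using count[OF _ nbh_H_lists(9)[OF m]] by (simp add: q_def y_def)
  next
    case (Suc l)
    with that have "Suc l < m" by simp
    from count[OF _ nbh_H_lists(11)[OF this]] show ?thesis
      by (simp add: Suc q_def y_def outs.simps add_ac)
  qed
  have step: "c i + \<Phi> (Suc i) \<le> 2 + \<Phi> i" if "i < m" for i
  proof -
    have "{1..9} = {1, 2, 3, 4, 5, 6, 7, 8, 9 :: nat}" by auto
    then have c: "c i = of_bool (q i 1) + of_bool (q i 2) + of_bool (q i 3) + of_bool (q i 4) + of_bool (q i 5)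
        + of_bool (q i 6) + of_bool (q i 7) + of_bool (q i 8) + of_bool (q i 9)"
      by (simp add: c_def)
    have "x (Suc i) = outs [q i 4, q i 8]" "y (Suc i) = outs [q i 7, q i 8]"
      by (simp_all add: x_def y_def)
    then show ?thesis
      unfolding c \<Phi>_def q_Suc using potential_step[OF k inner[OF that] left[OF that] xy(1) right[OF that]]
      by (simp only:)
  qed
  have sum: "(\<Sum>i<n. c i) + \<Phi> n \<le> 2 * int n + \<Phi> 0" if "n \<le> m" for n
    using that
  proof (induction n)
    case (Suc n)
    then show ?case using step[of n] by simp
  qed simp
  have "x 0 = 0" "y 0 = 0" by (simp_all add: x_def y_def)
  then have start: "of_bool (q 0 0) + of_bool (q 0 10) + \<Phi> 0 \<le> 2"
    unfolding \<Phi>_def using potential_start[OF k, of "q 0 0" "q 0 10"] by (simp only:)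
  obtain l where l: "m = Suc l" using m by (cases m) auto
  have "\<Phi> m \<ge> 0"
  proof -
    have "x m + outs [q m 10] = k" if "q m 0"
      using that count[OF _ nbh_H_lists(12)[OF l[symmetric]]] by (simp add: l q_def x_def outs.simps)
    moreover have "y m + outs [q m 0] = k" if "q m 10"
      using that count[OF _ nbh_H_lists(13)[OF l[symmetric]]] by (simp add: l q_def y_def outs.simps)
    ultimately show ?thesis unfolding \<Phi>_def by (intro potential_end[OF k _ _ xy]) simp_all
  qed
  have "card Q = (\<Sum>v\<in>verts (H m). of_bool (v \<in> Q))"
    using Q finite_verts_H[OF m] by (simp add: Int_absorb1)
  then have "int (card Q) = (\<Sum>v\<in>verts (H m). of_bool (v \<in> Q))" by simp
  also have "\<dots> = of_bool (q 0 0) + of_bool (q 0 10) + (\<Sum>i<m. c i)"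
    unfolding sum_verts_H[OF m] c_def by (simp add: q_def)
  also have "\<dots> \<le> 2 * int m + 2" using sum[of m] start \<open>\<Phi> m \<ge> 0\<close> by simp
  finally show ?thesis by linarith
qed

lemma card_or_set_H_le:
  assumes m: "0 < m" and Q: "or_set (H m) Q"
  shows "card Q \<le> 2 * m + 2"
proof (cases "Q = {}")
  case False
  then obtain v where v: "v \<in> Q" by blast
  have QV: "Q \<subseteq> verts (H m)" using Q by (simp add: or_set_def)
  define k where "k = card (nbh (H m) v - Q)"
  have "k \<le> card (nbh (H m) v)"
    unfolding k_def using finite_verts_H[OF m] by (intro card_mono) (auto simp: nbh_def)
  also have "\<dots> \<le> 7" using card_nbh_H_le v QV by blast
  finally have "k \<le> 7" .
  moreover have "0 < k" using Q v unfolding or_set_def k_def by blast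
  ultimately have "k \<in> {1, 2, 3, 4, 5, 6, 7}" by auto
  moreover have "card (nbh (H m) u - Q) = k" if "u \<in> Q" for u
    using Q v that unfolding or_set_def k_def by blast
  ultimately show ?thesis using card_le_of_uniform_or_set[OF m _ QV] by blast
qed simp

text \<open>Labels 3 and 7 have degree 2 in every copy, and so has \<open>(0, 0)\<close>. In the
  last copy the side \<open>{5, 6}\<close> is not glued: its two ends are adjacent and have two
  further neighbours each, so they replace 7 and gain one element. Every member has exactly two
  outside neighbours.\<close>

lemma or_set_H_witness:
  assumes m: "2 \<le> m"
  defines "Q \<equiv> {(0, 0)} \<union> {..<m} \<times> {3} \<union> {..<m - 1} \<times> {7} \<union> {(m - 1, 5), (m - 1, 6)}"
  shows "or_set (H m) Q" "card Q = 2 * m + 2"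
proof -
  obtain l where l: "m = Suc l" "0 < l" using m by (cases m) auto
  have sub: "Q \<subseteq> verts (H m)" using m by (auto simp: Q_def verts_H)
  have mem: "(i, j) \<in> Q \<longleftrightarrow> i = 0 \<and> j = 0 \<or> i < m \<and> j = 3 \<or> i < l \<and> j = 7 \<or> i = l \<and> (j = 5 \<or> j = 6)" for i j
    by (auto simp: Q_def l)
  have count: "card (nbh (H m) v - Q) = 2"
    if "nbh (H m) v = set xs" "distinct xs" "outs (map (\<lambda>u. u \<in> Q) xs) = 2" for v xs
    using that card_diff_eq_outs[of xs Q] by simp
  have "card (nbh (H m) v - Q) = 2" if v: "v \<in> Q" for v
  proof -
    from v consider "v = (0, 0)" | i where "i < m" "v = (i, 3)" | i where "i < l" "v = (i, 7)"
      | "v = (l, 5)" | "v = (l, 6)"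
      by (cases v) (auto simp: mem)
    then show ?thesis
    proof cases
      case 1
      show ?thesis unfolding 1 by (rule count[OF nbh_H_lists(8)]) (use l in \<open>simp_all add: mem\<close>)
    next
      case (2 i)
      show ?thesis unfolding 2(2) by (rule count[OF nbh_H_lists(3)]) (use l 2 in \<open>simp_all add: mem\<close>)
    next
      case (3 i)
      show ?thesis unfolding 3(2) by (rule count[OF nbh_H_lists(5)]) (use l 3 in \<open>simp_all add: mem\<close>)
    next
      case 4
      show ?thesis unfolding 4 by (rule count[OF nbh_H_lists(12)]) (use l in \<open>simp_all add: mem\<close>)
    next
      case 5
      show ?thesis unfolding 5 by (rule count[OF nbh_H_lists(13)]) (use l in \<open>simp_all add: mem\<close>)
    qed
  qed
  with sub show "or_set (H m) Q" by (simp add: or_set_def)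
  show "card Q = 2 * m + 2"
    unfolding Q_def using m by - ((subst card_Un_disjoint, simp, simp, force)+, simp)
qed

section \<open>The values of both invariants and the limit\<close>

lemma xi_or_H:
  assumes "2 \<le> m"
  shows "xi_or (H m) = 2 * m + 2"
  unfolding xi_or_def
proof (rule Max_eqI)
  show "finite {card Q | Q. or_set (H m) Q}"
    using assms by (intro finite_or_set_cards finite_verts_H) simp
  show "2 * m + 2 \<in> {card Q | Q. or_set (H m) Q}"
    using or_set_H_witness[OF assms] by (metis (mono_tags, lifting) mem_Collect_eq)
qed (use card_or_set_H_le assms in auto)

lemma fd_H:
  assumes "2 \<le> m"
  shows "fd (H m) = 7 * m"
  using assms by (simp add: fd_eq_order_minus_xi_or finite_verts_H card_verts_H xi_or_H)

theorem theorem16: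
  shows "(\<forall>m\<ge>2. maximal_outerplanar (H m) \<and> card (verts (H m)) = 9 * m + 2 \<and>
            max_degree (H m) = 7 \<and> xi_or (H m) = 2 * m + 2 \<and> fd (H m) = 7 * m \<and>
            real (fd (H m)) = 7 * (real (card (verts (H m))) - 2) / 9) \<and>
         (\<lambda>m. real (fd (H m)) / real (card (verts (H m)))) \<longlonglongrightarrow> 7 / 9"
proof
  show "\<forall>m\<ge>2. maximal_outerplanar (H m) \<and> card (verts (H m)) = 9 * m + 2 \<and>
      max_degree (H m) = 7 \<and> xi_or (H m) = 2 * m + 2 \<and> fd (H m) = 7 * m \<and>
      real (fd (H m)) = 7 * (real (card (verts (H m))) - 2) / 9"
    by (simp add: maximal_outerplanar_H card_verts_H max_degree_H xi_or_H fd_H)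
  \<comment> \<open>The ratio \<open>7 * m / (9 * m + 2)\<close> after division by \<open>m\<close>;
    the values are known from \<open>m = 2\<close> on, hence equality only eventually.\<close>
  have "(\<lambda>m. 7 / (9 + 2 * inverse (real m))) \<longlonglongrightarrow> 7 / (9 + 2 * 0)"
    by (intro tendsto_intros lim_inverse_n) auto
  moreover have "eventually (\<lambda>m. 7 / (9 + 2 * inverse (real m)) = real (fd (H m)) / real (card (verts (H m)))) sequentially"
    using eventually_ge_at_top[of 2]
    by eventually_elim (simp add: fd_H card_verts_H field_simps)
  ultimately show "(\<lambda>m. real (fd (H m)) / real (card (verts (H m)))) \<longlonglongrightarrow> 7 / 9"
    using tendsto_cong by force
qed

end
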